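(* For any $r\in\mathbb{N}$ and any class $\mathcal{F}$ of graphs, $\mathcal{F}$ has a $(0,r,\mathrm{wcol}_r(\mathcal{F}))$-disjunctive distance-$(r,r)$ labelling scheme.
   Context: For a graph $G$ with a total order $<$ on $V(G)$ and an integer $r\ge0$, a vertex $v$ is weakly $r$-reachable from $u$ if there is a path of length at most $r$ between $u$ and $v$ such that $v\le w$ for every vertex $w$ on the path. $\mathrm{wcol}_r(G)$ is the minimum $k$ such that some total order on $V(G)$ has, for every vertex $u$, at most $k$ vertices weakly $r$-reachable from $u$; $\mathrm{wcol}_r(\mathcal{F})=\sup_{G\in\mathcal{F}}\mathrm{wcol}_r(G)$. An $(s,t,k)$-disjunctive distance-$(r,r)$ labelling scheme for $\mathcal{F}$ deterministically assigns to each vertex $x$ of each $G\in\mathcal{F}$ (vertex set $[n]$) a label $[(p_1(x)\mid \vec q_1(x)),\dots,(p_t(x)\mid\vec q_t(x))]$ (at most $t$ pairs) where $p_i(x)$ are binary strings of total length at most $s$ and $\vec q_i(x)$ are vectors of natural numbers ("equality codes") with at most $k$ entries in total; the decoder, given the labels of $x$ and $y$, chooses (depending only on the prefixes and the structure of the labels) a set of pairs of equality-code positions and outputs $1$ iff some chosen pair of codes (one from $x$'s label, one from $y$'s) are equal. The output must be $1$ iff $\mathsf{dist}_G(x,y)\le r$, for all $G\in\mathcal{F}$ and $x,y\in V(G)$.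
   Formalization: The formal theorem assumes r ≥ 1; for r = 0 the claim fails, since labels with zero pairs are empty and the decoder always outputs 0, while dist(x,x) = 0 requires output 1. *)

theory Defs
  imports "Graph_Theory.Graph_Theory" "HOL-Library.Extended_Nat"
begin

text \<open>A finite simple undirected graph is a \<^term>\<open>pair_graph\<close>: a finite loopless digraph
  whose arc relation is symmetric. Graphs in a class have vertex set [n] = {1, ..., n}.\<close>

definition graph_class :: "nat pair_pre_digraph set \<Rightarrow> bool" where
  "graph_class \<F> \<longleftrightarrow> (\<forall>G\<in>\<F>. pair_graph G \<and> (\<exists>n. pverts G = {1..n}))"

definition graph_dist :: "'a pair_pre_digraph \<Rightarrow> 'a \<Rightarrow> 'a \<Rightarrow> ereal" where
  "graph_dist G = wf_digraph.\<mu> (with_proj G) (\<lambda>_. 1)"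

text \<open>In the next two definitions \<open>R\<close> is the total order on the vertices:
  \<open>(v, w) \<in> R\<close> means that \<open>v\<close> is at most \<open>w\<close>.\<close>

definition weakly_reachable ::
  "'a pair_pre_digraph \<Rightarrow> 'a rel \<Rightarrow> nat \<Rightarrow> 'a \<Rightarrow> 'a \<Rightarrow> bool" where
  "weakly_reachable G R r u v \<longleftrightarrow>
     (\<exists>p. vpath p (with_proj G) \<and> hd p = u \<and> last p = v \<and> vwalk_length p \<le> r
        \<and> (\<forall>w\<in>set p. (v, w) \<in> R))"

definition wcol_graph :: "nat \<Rightarrow> 'a pair_pre_digraph \<Rightarrow> nat" where
  "wcol_graph r G = (LEAST k. \<exists>R. linear_order_on (pverts G) R \<and>
     (\<forall>u\<in>pverts G. card {v. weakly_reachable G R r u v} \<le> k))"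

definition wcol :: "nat \<Rightarrow> 'a pair_pre_digraph set \<Rightarrow> enat" where
  "wcol r \<F> = (SUP G\<in>\<F>. enat (wcol_graph r G))"

type_synonym label = "(bool list \<times> nat list) list"

text \<open>What the decoder may inspect before comparing codes: the prefixes, the number of pairs and
  the number of equality codes in each pair, but not the codes themselves.\<close>

type_synonym label_shape = "(bool list \<times> nat) list"

definition shape :: "label \<Rightarrow> label_shape" where
  "shape L = map (\<lambda>(p, q). (p, length q)) L"

text \<open>The position \<open>(i, j)\<close> is that of entry \<open>j\<close> of the code vector of pair \<open>i\<close>, counted from 0.\<close>

type_synonym code_pos = "nat \<times> nat"

definition code_positions :: "label \<Rightarrow> code_pos set" where
  "code_positions L = {(i, j). i < length L \<and> j < length (snd (L ! i))}"

definition code_at :: "label \<Rightarrow> code_pos \<Rightarrow> nat" where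
  "code_at L = (\<lambda>(i, j). snd (L ! i) ! j)"

text \<open>A decoder is given by the set of pairs of positions it chooses for two label shapes;
  pairs that are not positions of the two labels are ignored.\<close>

type_synonym decoder = "label_shape \<Rightarrow> label_shape \<Rightarrow> (code_pos \<times> code_pos) set"

definition decoder_output :: "decoder \<Rightarrow> label \<Rightarrow> label \<Rightarrow> bool" where
  "decoder_output D L L' \<longleftrightarrow>
     (\<exists>(a, b) \<in> D (shape L) (shape L') \<inter> code_positions L \<times> code_positions L'.
        code_at L a = code_at L' b)"

definition label_size_bound :: "nat \<Rightarrow> nat \<Rightarrow> enat \<Rightarrow> label \<Rightarrow> bool" where
  "label_size_bound s t k L \<longleftrightarrow>
     length L \<le> t \<and>
     (\<Sum>(p, q)\<leftarrow>L. length p) \<le> s \<and>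
     enat (\<Sum>(p, q)\<leftarrow>L. length q) \<le> k"

text \<open>The labels may depend on the graph, but a single decoder serves the whole class.
  For \<open>k = \<infinity>\<close> the number of codes in a label is unrestricted.\<close>

definition has_disjunctive_distance_labelling ::
  "nat \<Rightarrow> nat \<Rightarrow> enat \<Rightarrow> nat \<Rightarrow> nat pair_pre_digraph set \<Rightarrow> bool" where
  "has_disjunctive_distance_labelling s t k r \<F> \<longleftrightarrow>
     (\<exists>(lab :: nat pair_pre_digraph \<Rightarrow> nat \<Rightarrow> label) (D :: decoder).
        \<forall>G\<in>\<F>.
          (\<forall>x\<in>pverts G. label_size_bound s t k (lab G x)) \<and>
          (\<forall>x\<in>pverts G. \<forall>y\<in>pverts G.
             decoder_output D (lab G x) (lab G y) \<longleftrightarrow> graph_dist G x y \<le> ereal (real r)))"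

end

theory Submission
  imports Defs
begin

text \<open>Fix for each graph an order attaining the weak colouring number and list, at a vertex \<open>x\<close>,
  all weakly \<open>r\<close>-reachable vertices \<open>v\<close>, grouped by the least \<open>k\<close> such that \<open>v\<close> is weakly
  \<open>k\<close>-reachable from \<open>x\<close>. The minimum \<open>v\<close> of a shortest path from \<open>x\<close> to \<open>y\<close> is weakly reachable from
  both ends at distances adding up to \<open>dist x y\<close>, so \<open>dist x y \<le> r\<close> iff the labels of \<open>x\<close> and \<open>y\<close> share
  a vertex in groups whose indices add up to at most \<open>r\<close>. Group 0 consists of \<open>x\<close> alone; storing it
  as the very first code of group 1 leaves only \<open>r\<close> vectors, and no prefixes are needed.\<close>

section \<open>Walks and distance\<close>

lemma (in sym_digraph) vwalk_rev:
  assumes "vwalk p G"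
  shows "vwalk (rev p) G"
proof
  show "set (vwalk_arcs (rev p)) \<subseteq> arcs_ends G"
    using assms sym_arcs by (auto simp: set_vwalk_arcs_rev symmetric_def dest: symD)
qed (use assms in auto)

lemma length_vwalk_to_vpath: "length (vwalk_to_vpath p) \<le> length p"
proof (induction p rule: vwalk_to_vpath.induct)
  case (2 x xs)
  then show ?case
    using length_dropWhile_le[of "\<lambda>y. y \<noteq> x" xs] by (cases "x \<in> set xs") auto
qed simp

lemma (in pair_wf_digraph) vwalk_imp_awalk:
  assumes "vwalk p (with_proj G)"
  shows "awalk (hd p) (vwalk_arcs p) (last p)"
  using assms
proof (induction rule: vwalk_induct)
  case (Base u)
  then show ?case by (simp add: awalk_Nil_iff)
next
  case (Cons u v es)
  then show ?case by (auto simp: awalk_Cons_iff)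
qed

lemma (in pair_wf_digraph) graph_dist_le_iff:
  "graph_dist G x y \<le> ereal (real r) \<longleftrightarrow>
    (\<exists>p. vwalk p (with_proj G) \<and> hd p = x \<and> last p = y \<and> vwalk_length p \<le> r)"
    (is "?L \<longleftrightarrow> ?R")
proof
  have cost: "awalk_cost (\<lambda>_. 1) p = real (length p)" for p
    by (induction p) auto
  show ?R if ?L
  proof -
    \<comment> \<open>The distance is an infimum, for which only a strict upper bound immediately
      yields a walk. A walk of length below \<open>r + 1\<close> has length at most \<open>r\<close>
      by integrality.\<close>
    have "graph_dist G x y < ereal (real r + 1)"
      using that by (rule le_less_trans) simp
    then obtain p where p: "awalk x p y" "real (length p) < real r + 1"
      unfolding graph_dist_def \<mu>_def by (auto simp: INF_less_iff cost)
    then have "vwalk (awalk_verts x p) (with_proj G)"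
      by (blast intro: awalk_imp_vwalk)
    moreover have "vwalk_length (awalk_verts x p) \<le> r"
      using p(2) by (simp add: length_awalk_verts del: awalk_verts_with_proj_eq)
    ultimately show ?R
      using p(1) by (metis awalkE')
  qed
  show ?L if ?R
  proof -
    obtain p where p: "vwalk p (with_proj G)" "hd p = x" "last p = y" "vwalk_length p \<le> r"
      using \<open>?R\<close> by blast
    have "graph_dist G x y \<le> ereal (awalk_cost (\<lambda>_. 1) (vwalk_arcs p))"
      unfolding graph_dist_def using vwalk_imp_awalk[OF p(1)] p(2,3)
      by (intro min_cost_le_walk_cost) auto
    also have "\<dots> \<le> ereal (real r)"
      using p(4) by (simp add: cost vwalk_length_def del: vwalk_length_simp)
    finally show ?L .
  qed
qed

section \<open>Weak reachability\<close>

lemma weakly_reachable_mono: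
  "weakly_reachable G R k u v \<Longrightarrow> k \<le> l \<Longrightarrow> weakly_reachable G R l u v"
  unfolding weakly_reachable_def by (blast intro: le_trans)

lemma weakly_reachable_in_pverts: "weakly_reachable G R k u v \<Longrightarrow> v \<in> pverts G"
  unfolding weakly_reachable_def vpath_def vwalk_def by (metis last_in_set subsetD with_proj_simps(1))

text \<open>Cutting closed detours out of a walk keeps its ends, adds no vertices and does not
  lengthen it, so minimality of the last vertex survives on the resulting path.\<close>

lemma weakly_reachableI_vwalk:
  assumes "vwalk p (with_proj G)" "\<forall>w\<in>set p. (last p, w) \<in> R"
  shows "weakly_reachable G R (vwalk_length p) (hd p) (last p)"
  unfolding weakly_reachable_def
  using assms vwalk_to_vpath_vpath[OF assms(1)] vwalk_to_vpath_subset[of _ p]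
    length_vwalk_to_vpath[of p]
  by (intro exI[of _ "vwalk_to_vpath p"])
    (auto simp: vwalk_to_vpath_hd vwalk_to_vpath_last intro: diff_le_mono)

lemma weakly_reachable_0_iff:
  assumes "refl_on (pverts G) R" "u \<in> pverts G"
  shows "weakly_reachable G R 0 u v \<longleftrightarrow> v = u"
proof
  show "v = u" if "weakly_reachable G R 0 u v"
  proof -
    obtain p where "vpath p (with_proj G)" "hd p = u" "last p = v" "length p \<le> 1"
      using \<open>weakly_reachable G R 0 u v\<close> by (auto simp: weakly_reachable_def)
    then show ?thesis by (cases p) auto
  qed
  show "weakly_reachable G R 0 u v" if "v = u"
    using weakly_reachableI_vwalk[of "[u]" G R] assms that by (auto dest: refl_onD)
qed

lemma linear_order_on_obtains_least:
  assumes "linear_order_on A R" "finite S" "S \<noteq> {}" "S \<subseteq> A"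
  obtains v where "v \<in> S" "\<forall>w\<in>S. (v, w) \<in> R"
proof -
  have "\<exists>v\<in>S. \<forall>w\<in>S. (v, w) \<in> R"
    using assms(2,3,4)
  proof (induction rule: finite_ne_induct)
    case (singleton x)
    then show ?case using assms(1) by (auto simp: order_on_defs dest: refl_onD)
  next
    case (insert x S)
    then obtain v where v: "v \<in> S" "\<forall>w\<in>S. (v, w) \<in> R" by auto
    have R: "refl_on A R" "trans R" "total_on A R"
      using assms(1) by (auto simp: order_on_defs)
    have "(x, v) \<in> R \<or> (v, x) \<in> R"
      using R insert.prems v(1) by (metis insertCI refl_onD subsetD total_on_def)
    then show ?case
    proof
      assume "(x, v) \<in> R"
      then have "\<forall>w\<in>insert x S. (x, w) \<in> R"
        using v R insert.prems by (auto dest: refl_onD transD)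
      then show ?case by blast
    qed (use v in auto)
  qed
  then show ?thesis using that by blast
qed

text \<open>One direction splits a walk of length at most \<open>r\<close> at its least vertex; the
  other glues two witnessing paths at their common end \<open>v\<close>.\<close>

lemma (in pair_graph) graph_dist_le_iff_weakly_reachable:
  assumes "linear_order_on (pverts G) R"
  shows "graph_dist G x y \<le> ereal (real r) \<longleftrightarrow>
    (\<exists>k l v. weakly_reachable G R k x v \<and> weakly_reachable G R l y v \<and> k + l \<le> r)"
    (is "?L \<longleftrightarrow> ?R")
proof
  show ?R if ?L
  proof -
    obtain p where p: "vwalk p (with_proj G)" "hd p = x" "last p = y" "vwalk_length p \<le> r"
      using \<open>?L\<close> unfolding graph_dist_le_iff by blast
    obtain v where v: "v \<in> set p" "\<forall>w\<in>set p. (v, w) \<in> R"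
      using linear_order_on_obtains_least[OF assms, of "set p"] p(1) by (auto simp: vwalk_def)
    then obtain as bs where split: "p = as @ v # bs" by (meson split_list)
    have "vwalk (as @ [v]) (with_proj G)"
      using vwalkI_append_l[of "as @ [v]" bs] p(1) split by simp
    then have "weakly_reachable G R (length as) x v"
      using weakly_reachableI_vwalk[of "as @ [v]" G R] v(2) p(2) split
      by (cases as) auto
    \<comment> \<open>The second half runs from \<open>v\<close> to \<open>y\<close>; symmetry of
      the arcs lets it be read from \<open>y\<close> back to \<open>v\<close>.\<close>
    moreover have "vwalk (rev (v # bs)) (with_proj G)"
      using vwalkI_append_r[of "v # bs" as] p(1) split by (intro vwalk_rev) simp
    then have "weakly_reachable G R (length bs) y v"
      using weakly_reachableI_vwalk[of "rev (v # bs)" G R] v(2) p(3) split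
      by (auto simp: hd_append hd_rev)
    moreover have "length as + length bs \<le> r"
      using p(4) split by simp
    ultimately show ?R by blast
  qed
  show ?L if ?R
  proof -
    obtain k l v p q where
      p: "vwalk p (with_proj G)" "hd p = x" "last p = v" "vwalk_length p \<le> k" and
      q: "vwalk q (with_proj G)" "hd q = y" "last q = v" "vwalk_length q \<le> l" and
      kl: "k + l \<le> r"
      using \<open>?R\<close> unfolding weakly_reachable_def vpath_def by blast
    then have len: "vwalk_length p + vwalk_length q \<le> r"
      by linarith
    have j: "joinable p (rev q)"
      using p q by (auto simp: joinable_def vwalk_def hd_rev)
    \<comment> \<open>The two paths may intersect, but a walk suffices for
      \<open>graph_dist_le_iff\<close>.\<close>
    have "vwalk (p \<oplus> rev q) (with_proj G)"
      using p q vwalk_rev j by (intro vwalk_joinI_vwalk) auto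
    moreover have "hd (p \<oplus> rev q) = x" "last (p \<oplus> rev q) = y"
      using p q j by (auto simp: vwalk_join_hd vwalk_join_last last_rev vwalk_def)
    moreover have "vwalk_length (p \<oplus> rev q) \<le> r"
      using j len by (simp add: vwalk_join_def joinable_def)
    ultimately show ?L
      unfolding graph_dist_le_iff by blast
  qed
qed

text \<open>The \<open>LEAST\<close> in \<open>wcol_graph\<close> is attained because some bound is
  admissible: \<open>card (pverts G)\<close> works for every linear order.\<close>

lemma wcol_graph_order:
  assumes "finite (pverts G)"
  obtains R where "linear_order_on (pverts G) R"
    "\<And>u. u \<in> pverts G \<Longrightarrow> card {v. weakly_reachable G R r u v} \<le> wcol_graph r G"
proof -
  obtain R where R: "linear_order_on (pverts G) R"
    using well_order_on[of "pverts G"] by (auto simp: well_order_on_def)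
  have "card {v. weakly_reachable G R r u v} \<le> card (pverts G)" for u
    using assms weakly_reachable_in_pverts by (intro card_mono) fastforce+
  with R have "\<exists>k R. linear_order_on (pverts G) R \<and>
      (\<forall>u\<in>pverts G. card {v. weakly_reachable G R r u v} \<le> k)"
    by blast
  from LeastI_ex[OF this] show ?thesis
    using that by (auto simp: wcol_graph_def)
qed

section \<open>The labelling\<close>

definition reach_layer :: "'a pair_pre_digraph \<Rightarrow> 'a rel \<Rightarrow> nat \<Rightarrow> 'a \<Rightarrow> 'a set" where
  "reach_layer G R k u = {v. weakly_reachable G R k u v \<and> (\<forall>j<k. \<not> weakly_reachable G R j u v)}"

text \<open>Vectors are counted from 0, so vector \<open>i\<close> carries layer
  \<open>Suc i\<close>.\<close>

definition layer_codes :: "nat pair_pre_digraph \<Rightarrow> nat rel \<Rightarrow> nat \<Rightarrow> nat \<Rightarrow> nat list" where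
  "layer_codes G R u i =
    (if i = 0 then [u] else []) @ sorted_list_of_set (reach_layer G R (Suc i) u)"

definition reach_label :: "nat pair_pre_digraph \<Rightarrow> nat rel \<Rightarrow> nat \<Rightarrow> nat \<Rightarrow> label" where
  "reach_label G R r u = map (\<lambda>i. ([], layer_codes G R u i)) [0..<r]"

text \<open>The layer of the code stored at a position. It is read off the position alone, so one
  fixed set of pairs can serve all graphs.\<close>

definition pos_dist :: "code_pos \<Rightarrow> nat" where
  "pos_dist a = (if a = (0, 0) then 0 else Suc (fst a))"

definition reach_decoder :: "nat \<Rightarrow> decoder" where
  "reach_decoder r = (\<lambda>_ _. {(a, b). pos_dist a + pos_dist b \<le> r})"

lemma finite_reach_layer: "finite (pverts G) \<Longrightarrow> finite (reach_layer G R k u)"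
  by (rule finite_subset[of _ "pverts G"])
    (auto simp: reach_layer_def weakly_reachable_in_pverts)

lemma reach_layer_least:
  assumes "weakly_reachable G R k u v"
  obtains j where "j \<le> k" "v \<in> reach_layer G R j u"
proof
  show "(LEAST j. weakly_reachable G R j u v) \<le> k"
    using assms by (rule Least_le)
  show "v \<in> reach_layer G R (LEAST j. weakly_reachable G R j u v) u"
    using assms by (auto simp: reach_layer_def intro: LeastI dest: not_less_Least)
qed

text \<open>The layers are pairwise disjoint, as the least radius is unique, and up to index
  \<open>r\<close> they lie inside the weakly \<open>r\<close>-reachable set.\<close>

lemma sum_card_reach_layer_le:
  assumes "finite (pverts G)"
  shows "(\<Sum>k\<le>r. card (reach_layer G R k u)) \<le> card {v. weakly_reachable G R r u v}"
proof -
  have "(\<Sum>k\<le>r. card (reach_layer G R k u)) = card (\<Union>k\<le>r. reach_layer G R k u)"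
  proof (rule card_UN_disjoint[symmetric])
    have "k = l" if "v \<in> reach_layer G R k u" "v \<in> reach_layer G R l u" for k l v
      using that by (auto simp: reach_layer_def) (metis nat_neq_iff)
    then show "\<forall>k\<in>{..r}. \<forall>l\<in>{..r}. k \<noteq> l \<longrightarrow> reach_layer G R k u \<inter> reach_layer G R l u = {}"
      by blast
  qed (use assms finite_reach_layer in auto)
  also have "\<dots> \<le> card {v. weakly_reachable G R r u v}"
  proof (rule card_mono)
    show "finite {v. weakly_reachable G R r u v}"
      by (rule finite_subset[OF _ assms]) (auto simp: weakly_reachable_in_pverts)
  qed (auto simp: reach_layer_def intro: weakly_reachable_mono)
  finally show ?thesis .
qed

lemma label_size_bound_reach_label:
  assumes "finite (pverts G)" "refl_on (pverts G) R" "u \<in> pverts G" "r \<ge> 1"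
    and "enat (card {v. weakly_reachable G R r u v}) \<le> k"
  shows "label_size_bound 0 r k (reach_label G R r u)"
proof -
  have 0: "reach_layer G R 0 u = {u}"
    using weakly_reachable_0_iff[OF assms(2,3)] by (auto simp: reach_layer_def)
  have "(\<Sum>(p, q)\<leftarrow>reach_label G R r u. length q) = (\<Sum>i<r. length (layer_codes G R u i))"
    by (simp add: reach_label_def comp_def interv_sum_list_conv_sum_set_nat atLeast0LessThan)
  also have "\<dots> = (\<Sum>i<r. (if i = 0 then 1 else 0) + card (reach_layer G R (Suc i) u))"
    by (intro sum.cong) (auto simp: layer_codes_def)
  \<comment> \<open>The extra code in vector 0, which exists since \<open>r \<ge> 1\<close>, pays
    for the singleton layer 0; the rest is an index shift.\<close>
  also have "\<dots> = (\<Sum>k\<le>r. card (reach_layer G R k u))"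
    using assms(4) 0 by (simp add: sum.distrib sum.atMost_shift)
  also have "\<dots> \<le> card {v. weakly_reachable G R r u v}"
    using assms(1) by (rule sum_card_reach_layer_le)
  finally have "enat (\<Sum>(p, q)\<leftarrow>reach_label G R r u. length q) \<le> k"
    using assms(5) by (meson enat_ord_simps(1) order_trans)
  moreover have "(\<Sum>(p, q)\<leftarrow>reach_label G R r u. length p) = 0"
    by (simp add: reach_label_def comp_def)
  ultimately show ?thesis
    by (simp add: label_size_bound_def) (simp add: reach_label_def)
qed

lemma mem_code_positions_reach_label:
  "(i, j) \<in> code_positions (reach_label G R r u) \<longleftrightarrow> i < r \<and> j < length (layer_codes G R u i)"
  by (auto simp: code_positions_def reach_label_def)

lemma code_at_reach_label: "i < r \<Longrightarrow> code_at (reach_label G R r u) (i, j) = layer_codes G R u i ! j"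
  by (simp add: code_at_def reach_label_def)

text \<open>Soundness of the positions: \<open>pos_dist\<close> is a radius within which the stored
  vertex is reached.\<close>

lemma weakly_reachable_code_at:
  assumes "finite (pverts G)" "refl_on (pverts G) R" "u \<in> pverts G"
    and "a \<in> code_positions (reach_label G R r u)"
  shows "weakly_reachable G R (pos_dist a) u (code_at (reach_label G R r u) a)"
proof (cases "a = (0, 0)")
  case True
  then show ?thesis
    using assms weakly_reachable_0_iff[OF assms(2,3)]
    by (auto simp: mem_code_positions_reach_label code_at_reach_label layer_codes_def pos_dist_def)
next
  case False
  obtain i j where a: "a = (i, j)" by fastforce
  with assms(4) have ij: "i < r" "j < length (layer_codes G R u i)"
    by (auto simp: mem_code_positions_reach_label)
  \<comment> \<open>Only \<open>(0, 0)\<close> holds the additional code \<open>u\<close>; in vector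
    0 the layer itself starts at entry 1.\<close>
  have "layer_codes G R u i ! j \<in> set (sorted_list_of_set (reach_layer G R (Suc i) u))"
  proof (cases "i = 0")
    case True
    with False a obtain j' where "j = Suc j'" by (cases j) auto
    with True ij(2) show ?thesis
      by (simp add: layer_codes_def del: set_sorted_list_of_set)
  next
    case False
    with ij(2) show ?thesis
      by (simp add: layer_codes_def del: set_sorted_list_of_set)
  qed
  then show ?thesis
    using False a ij(1) finite_reach_layer[OF assms(1)]
    by (auto simp: code_at_reach_label pos_dist_def reach_layer_def)
qed

text \<open>Completeness of the positions. The vertex \<open>v\<close> is stored in the layer of its
  least radius, which may be below \<open>k\<close>; this only helps the decoder, whose test is an
  upper bound on a sum.\<close>

lemma weakly_reachable_imp_code_at:
  assumes "finite (pverts G)" "refl_on (pverts G) R" "u \<in> pverts G" "r \<ge> 1"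
    and "weakly_reachable G R k u v" "k \<le> r"
  obtains a where "a \<in> code_positions (reach_label G R r u)"
    "code_at (reach_label G R r u) a = v" "pos_dist a \<le> k"
proof -
  obtain l where l: "l \<le> k" "v \<in> reach_layer G R l u"
    using assms(5) by (rule reach_layer_least)
  show ?thesis
  proof (cases l)
    case 0
    then have "v = u"
      using l(2) weakly_reachable_0_iff[OF assms(2,3)] by (simp add: reach_layer_def)
    then show ?thesis
      using that[of "(0, 0)"] assms(4)
      by (simp add: mem_code_positions_reach_label code_at_reach_label layer_codes_def pos_dist_def)
  next
    case (Suc i)
    then have "v \<in> set (layer_codes G R u i)"
      using l(2) finite_reach_layer[OF assms(1)] by (simp add: layer_codes_def)
    then obtain j where "j < length (layer_codes G R u i)" "layer_codes G R u i ! j = v"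
      by (meson in_set_conv_nth)
    then show ?thesis
      using that[of "(i, j)"] l(1) Suc assms(6)
      by (simp add: mem_code_positions_reach_label code_at_reach_label pos_dist_def)
  qed
qed

text \<open>Equal codes at a chosen pair of positions amount to a common weakly reachable vertex
  with radii adding up to at most \<open>r\<close>.\<close>

lemma decoder_output_reach_label:
  assumes "pair_graph G"
    and R: "linear_order_on (pverts G) R" and "r \<ge> 1" "x \<in> pverts G" "y \<in> pverts G"
  shows "decoder_output (reach_decoder r) (reach_label G R r x) (reach_label G R r y) \<longleftrightarrow>
    graph_dist G x y \<le> ereal (real r)"
    (is "?L \<longleftrightarrow> ?R")
proof
  interpret pair_graph G by fact
  have refl: "refl_on (pverts G) R" and fin: "finite (pverts G)"
    using R by (auto simp: order_on_defs)
  show ?R if ?L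
  proof -
    obtain a b where ab: "a \<in> code_positions (reach_label G R r x)"
      "b \<in> code_positions (reach_label G R r y)" "pos_dist a + pos_dist b \<le> r"
      "code_at (reach_label G R r x) a = code_at (reach_label G R r y) b"
      using \<open>?L\<close> by (auto simp: decoder_output_def reach_decoder_def)
    then show ?R
      using weakly_reachable_code_at[OF fin refl assms(4) ab(1)]
        weakly_reachable_code_at[OF fin refl assms(5) ab(2)]
      unfolding graph_dist_le_iff_weakly_reachable[OF R] by metis
  qed
  show ?L if ?R
  proof -
    obtain k l v where kl: "weakly_reachable G R k x v" "weakly_reachable G R l y v" "k + l \<le> r"
      using \<open>?R\<close> unfolding graph_dist_le_iff_weakly_reachable[OF R] by blast
    obtain a where a: "a \<in> code_positions (reach_label G R r x)"
      "code_at (reach_label G R r x) a = v" "pos_dist a \<le> k"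
      using weakly_reachable_imp_code_at[OF fin refl assms(4,3) kl(1)] kl(3) by auto
    obtain b where b: "b \<in> code_positions (reach_label G R r y)"
      "code_at (reach_label G R r y) b = v" "pos_dist b \<le> l"
      using weakly_reachable_imp_code_at[OF fin refl assms(5,3) kl(2)] kl(3) by auto
    have "(a, b) \<in> reach_decoder r (shape (reach_label G R r x)) (shape (reach_label G R r y))
        \<inter> code_positions (reach_label G R r x) \<times> code_positions (reach_label G R r y)"
      using a b kl(3) by (simp add: reach_decoder_def)
    then show ?L
      unfolding decoder_output_def using a(2) b(2) by (intro bexI[of _ "(a, b)"]) auto
  qed
qed

text \<open>For \<open>r = 0\<close> a label would have no pairs, so the output would always be
  negative, although each vertex is at distance 0 from itself; hence
  \<open>r \<ge> 1\<close>.\<close>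

theorem theorem4p14:
  fixes r :: nat and \<F> :: "nat pair_pre_digraph set"
  assumes "r \<ge> 1"
    and "graph_class \<F>"
  shows "has_disjunctive_distance_labelling 0 r (wcol r \<F>) r \<F>"
proof -
  have graph: "pair_graph G" "finite (pverts G)" if "G \<in> \<F>" for G
    using assms(2) that by (auto simp: graph_class_def)
  then have "\<exists>R. linear_order_on (pverts G) R \<and>
      (\<forall>u\<in>pverts G. card {v. weakly_reachable G R r u v} \<le> wcol_graph r G)" if "G \<in> \<F>" for G
    using that by (metis wcol_graph_order)
  \<comment> \<open>An optimal order is chosen separately for each graph; it enters only the labels,
    while \<open>reach_decoder r\<close> depends on \<open>r\<close> alone.\<close>
  then obtain R where R: "\<And>G. G \<in> \<F> \<Longrightarrow> linear_order_on (pverts G) (R G)"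
    and card: "\<And>G u. G \<in> \<F> \<Longrightarrow> u \<in> pverts G \<Longrightarrow>
      card {v. weakly_reachable G (R G) r u v} \<le> wcol_graph r G"
    by metis
  have "label_size_bound 0 r (wcol r \<F>) (reach_label G (R G) r x)"
    if "G \<in> \<F>" "x \<in> pverts G" for G x
  proof (rule label_size_bound_reach_label)
    show "refl_on (pverts G) (R G)"
      using R[OF that(1)] by (simp add: order_on_defs)
    have "enat (card {v. weakly_reachable G (R G) r x v}) \<le> enat (wcol_graph r G)"
      using card that by simp
    also have "\<dots> \<le> wcol r \<F>"
      unfolding wcol_def using that(1) by (rule SUP_upper)
    finally show "enat (card {v. weakly_reachable G (R G) r x v}) \<le> wcol r \<F>" .
  qed (use that graph assms(1) in auto)
  moreover have "decoder_output (reach_decoder r) (reach_label G (R G) r x) (reach_label G (R G) r y)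
      \<longleftrightarrow> graph_dist G x y \<le> ereal (real r)"
    if "G \<in> \<F>" "x \<in> pverts G" "y \<in> pverts G" for G x y
    using decoder_output_reach_label[OF graph(1) R] that assms(1) by blast
  ultimately show ?thesis
    unfolding has_disjunctive_distance_labelling_def
    by (intro exI[of _ "\<lambda>G. reach_label G (R G) r"] exI[of _ "reach_decoder r"]) blast
qed

end
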